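(* Suppose that $c_1, c_2, c_3$ are three real constants with $0<c_1<c_2<c_3<1$, $c_3-\frac{c_1(1-c_3)}{1-c_1}\le c_2$ and $c_1\ge c_3c_2$. Let $G$ be a graph and, for every vertex $v\in V(G)$, let $a_v^-,a_v^+$ be integers such that $c_1 d_G(v)\le a_v^-\le c_2 d_G(v)\le a_v^+\le c_3 d_G(v)$, and let $L(v)=\{a_v^-,\,a_v^-+1,\,a_v^+,\,a_v^++1\}$. Then $G$ contains an $L$-factor.
   Context: All graphs are finite, undirected and simple; $d_G(v)$ denotes the degree of $v$ in $G$. Let $L:V(G)\to 2^{\mathbb N}$ be a function assigning to each vertex a set of nonnegative integers. An $L$-factor of $G$ is a spanning subgraph $H$ of $G$ such that $d_H(v)\in L(v)$ for all $v\in V(G)$. *)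

theory Defs
  imports Complex_Main
begin

text \<open>A finite simple undirected graph is a pair of a vertex set and a set of
  two-element subsets of it.\<close>

type_synonym 'v ugraph = "'v set \<times> 'v set set"

definition verts :: "'v ugraph \<Rightarrow> 'v set" where
  "verts G = fst G"

definition edges :: "'v ugraph \<Rightarrow> 'v set set" where
  "edges G = snd G"

definition simple_graph :: "'v ugraph \<Rightarrow> bool" where
  "simple_graph G \<longleftrightarrow>
     finite (verts G) \<and> (\<forall>e\<in>edges G. e \<subseteq> verts G \<and> card e = 2)"

definition degree :: "'v ugraph \<Rightarrow> 'v \<Rightarrow> nat" where
  "degree G v = card {e \<in> edges G. v \<in> e}"

definition spanning_subgraph :: "'v ugraph \<Rightarrow> 'v ugraph \<Rightarrow> bool" where
  "spanning_subgraph H G \<longleftrightarrow>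
     simple_graph H \<and> verts H = verts G \<and> edges H \<subseteq> edges G"

definition L_factor :: "('v \<Rightarrow> nat set) \<Rightarrow> 'v ugraph \<Rightarrow> 'v ugraph \<Rightarrow> bool" where
  "L_factor L G H \<longleftrightarrow>
     spanning_subgraph H G \<and> (\<forall>v\<in>verts G. degree H v \<in> L v)"

end

theory Submission
  imports Defs
begin

text \<open>
  At every vertex the degree must fall into one of two windows of two consecutive integers, the
  low one starting at \<open>am v\<close> and the high one at \<open>ap v\<close>. Choose a window for each vertex, with
  lower end \<open>a v\<close>, together with a subgraph \<open>H\<close> that exceeds no window, such that the total
  deficiency, the sum of the positive parts of \<open>a v - deg H v\<close>, is as small as possible. Suppose
  that some vertex \<open>u\<close> is still deficient.

  Push this defect along alternating walks: add an edge at \<open>u\<close>, remove an edge at its other end,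
  and so on. After each step the degrees are those of \<open>H\<close>, except for an extra unit at \<open>u\<close> and an
  extra unit or a missing unit at the current end. Let \<open>A\<close> be the set of vertices at which a unit can
  be missing and \<open>B\<close> the set of those at which a unit can be in excess. By minimality, vertices of
  \<open>A\<close> have degree at most \<open>a v\<close> and those of \<open>B\<close> have degree exactly \<open>a v + 1\<close>. Hence \<open>A\<close> and \<open>B\<close>
  are disjoint; it is here that windows of two consecutive integers matter, since otherwise parity
  obstructions would arise. Moreover every edge outside \<open>H\<close> at a vertex of \<open>A\<close> ends in \<open>B\<close>, and
  every edge of \<open>H\<close> at a vertex of \<open>B\<close> ends in \<open>A\<close>. Counting the edges between \<open>A\<close> and \<open>B\<close> gives
    \<open>e(A, B) > (\<Sum>v\<in>A. d v - a v) + (\<Sum>w\<in>B. a w + 1)\<close>.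

  Count each of these edges with weight \<open>1 - c2\<close> at its end in \<open>A\<close> and weight \<open>c2\<close> at its end in
  \<open>B\<close>. Then some \<open>v\<close> in \<open>A\<close> has \<open>(1 - c2) d\<^sub>B v > d v - a v\<close>, or some \<open>w\<close> in \<open>B\<close> has
  \<open>c2 d\<^sub>A w > a w + 1\<close>. In the first case the bounds on the constants force the window of \<open>v\<close> to be
  the high one and fewer than \<open>c1 d v\<close> of its edges to avoid \<open>B\<close>. So, with the missing unit moved to
  \<open>v\<close>, edges from \<open>v\<close> to \<open>B\<close> can be deleted until \<open>v\<close> fits into its low window. This makes no
  vertex of \<open>B\<close> deficient, because these vertices are at the top of their windows. In the second
  case \<open>w\<close> has the low window and more than \<open>c3 d w\<close> edges to \<open>A\<close>, and it can symmetrically be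
  lifted into its high window by adding edges to \<open>A\<close>. In both cases the deficiency drops, a
  contradiction.
\<close>

section \<open>Degrees in edge sets\<close>

definition deg :: "'v set set \<Rightarrow> 'v \<Rightarrow> nat" where
  "deg F v = card {e \<in> F. v \<in> e}"

definition nbrs :: "'v set set \<Rightarrow> 'v \<Rightarrow> 'v set" where
  "nbrs F v = {w. {v, w} \<in> F}"

definition star :: "'v \<Rightarrow> 'v set \<Rightarrow> 'v set set" where
  "star v X = (\<lambda>w. {v, w}) ` X"

lemma deg_Un:
  assumes "finite F" "finite F'" "F \<inter> F' = {}"
  shows "deg (F \<union> F') v = deg F v + deg F' v"
proof -
  have "{e \<in> F \<union> F'. v \<in> e} = {e \<in> F. v \<in> e} \<union> {e \<in> F'. v \<in> e}" by auto
  moreover have "card ({e \<in> F. v \<in> e} \<union> {e \<in> F'. v \<in> e})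
      = card {e \<in> F. v \<in> e} + card {e \<in> F'. v \<in> e}"
    using assms by (intro card_Un_disjoint) auto
  ultimately show ?thesis unfolding deg_def by simp
qed

lemma deg_Diff:
  assumes "finite F" "F' \<subseteq> F"
  shows "deg (F - F') v + deg F' v = deg F v"
proof -
  have "deg ((F - F') \<union> F') v = deg (F - F') v + deg F' v"
    using assms by (intro deg_Un) (auto intro: finite_subset)
  moreover have "(F - F') \<union> F' = F" using assms by auto
  ultimately show ?thesis by simp
qed

lemma inj_on_doubleton: "inj_on (\<lambda>w. {v, w}) X"
  by (auto simp: inj_on_def doubleton_eq_iff)

lemma deg_star_centre: "deg (star v X) v = card X"
proof -
  have "{e \<in> star v X. v \<in> e} = (\<lambda>w. {v, w}) ` X" unfolding star_def by auto
  then show ?thesis unfolding deg_def by (simp add: card_image inj_on_doubleton)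
qed

lemma deg_star_leaf:
  assumes "x \<noteq> v"
  shows "deg (star v X) x = of_bool (x \<in> X)"
proof -
  have "{e \<in> star v X. x \<in> e} = (if x \<in> X then {{v, x}} else {})"
    using assms unfolding star_def by auto
  then show ?thesis unfolding deg_def by simp
qed

lemma double_count_nbrs:
  assumes "finite X" "finite Y"
  shows "(\<Sum>x\<in>X. card (nbrs F x \<inter> Y)) = (\<Sum>y\<in>Y. card (nbrs F y \<inter> X))"
proof -
  have count: "card (nbrs F x \<inter> Z) = (\<Sum>z\<in>Z. of_bool ({x, z} \<in> F))" if "finite Z" for x Z
  proof -
    have "nbrs F x \<inter> Z = {z \<in> Z. {x, z} \<in> F}" unfolding nbrs_def by auto
    then show ?thesis using that by (simp add: of_bool_def sum.If_cases Int_def)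
  qed
  have "(\<Sum>x\<in>X. card (nbrs F x \<inter> Y)) = (\<Sum>x\<in>X. \<Sum>y\<in>Y. of_bool ({x, y} \<in> F))"
    by (simp only: count[OF assms(2)])
  also have "\<dots> = (\<Sum>y\<in>Y. \<Sum>x\<in>X. of_bool ({x, y} \<in> F))" by (rule sum.swap)
  also have "\<dots> = (\<Sum>y\<in>Y. card (nbrs F y \<inter> X))"
    by (simp only: count[OF assms(1)] insert_commute)
  finally show ?thesis .
qed

locale simple_edges =
  fixes V :: "'v set" and E :: "'v set set"
  assumes finite_V: "finite V"
    and edge: "\<And>e. e \<in> E \<Longrightarrow> e \<subseteq> V \<and> card e = 2"
begin

lemma finite_E: "finite E"
proof (rule finite_subset)
  show "E \<subseteq> Pow V" using edge by auto
qed (simp add: finite_V)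

lemma edge_ends:
  assumes "{v, w} \<in> E"
  shows "v \<in> V" "w \<in> V" "v \<noteq> w"
  using edge[OF assms] by auto

lemma nbrs_subset: "nbrs E v \<subseteq> V"
  unfolding nbrs_def using edge_ends by auto

lemma finite_nbrs:
  assumes "F \<subseteq> E"
  shows "finite (nbrs F v)"
  using assms nbrs_subset[of v] finite_V unfolding nbrs_def by (auto intro: finite_subset)

lemma deg_eq_card_nbrs:
  assumes "F \<subseteq> E"
  shows "deg F v = card (nbrs F v)"
proof -
  have "{e \<in> F. v \<in> e} = (\<lambda>w. {v, w}) ` nbrs F v"
  proof (intro equalityI subsetI)
    fix e assume "e \<in> {e \<in> F. v \<in> e}"
    then have e: "e \<in> F" "v \<in> e" by auto
    then have "card e = 2" using edge assms by blast
    then obtain x y where "e = {x, y}" by (auto simp: card_2_iff)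
    with e have "\<exists>w. e = {v, w}" by auto
    with e show "e \<in> (\<lambda>w. {v, w}) ` nbrs F v" unfolding nbrs_def by auto
  qed (auto simp: nbrs_def)
  then show ?thesis unfolding deg_def by (simp add: card_image inj_on_doubleton)
qed

end

section \<open>A subgraph of least deficiency\<close>

definition deficiency :: "'v set \<Rightarrow> ('v \<Rightarrow> nat) \<Rightarrow> 'v set set \<Rightarrow> nat" where
  "deficiency V a K = (\<Sum>v\<in>V. a v - deg K v)"

locale two_windows = simple_edges V E for V :: "'v set" and E :: "'v set set" +
  fixes m p :: "'v \<Rightarrow> nat"
begin

definition feasible :: "('v \<Rightarrow> nat) \<Rightarrow> 'v set set \<Rightarrow> bool" where
  "feasible a K \<longleftrightarrow> K \<subseteq> E \<and> (\<forall>v\<in>V. a v \<in> {m v, p v} \<and> deg K v \<le> a v + 1)"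

end

locale least_deficiency = two_windows V E m p
  for V :: "'v set" and E :: "'v set set" and m p :: "'v \<Rightarrow> nat" +
  fixes a :: "'v \<Rightarrow> nat" and H :: "'v set set" and u :: 'v
  assumes feasible_H: "feasible a H"
    and least: "\<And>a' K. feasible a' K \<Longrightarrow> deficiency V a H \<le> deficiency V a' K"
    and u_in_V: "u \<in> V"
    and u_deficient: "deg H u < a u"
begin

lemma H_subset: "H \<subseteq> E"
  using feasible_H unfolding feasible_def by auto

lemma window: "v \<in> V \<Longrightarrow> a v \<in> {m v, p v}"
  using feasible_H unfolding feasible_def by auto

lemma deg_H_le: "v \<in> V \<Longrightarrow> deg H v \<le> a v + 1"
  using feasible_H unfolding feasible_def by auto

text \<open>
  Deficiencies are compared vertex by vertex: each modification considered below helps strictly at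
  \<open>u\<close> and harms nowhere.
\<close>

lemma improvement:
  assumes "K \<subseteq> E"
    and "\<And>x. x \<in> V \<Longrightarrow> a' x \<in> {m x, p x} \<and> deg K x \<le> a' x + 1"
    and "\<And>x. x \<in> V \<Longrightarrow> a' x - deg K x \<le> a x - deg H x"
    and "a' u - deg K u < a u - deg H u"
  shows "feasible a' K \<and> deficiency V a' K < deficiency V a H"
  using assms u_in_V finite_V unfolding feasible_def deficiency_def
  by (intro conjI sum_strict_mono_ex1) auto

lemma no_improvement: "\<not> (feasible a' K \<and> deficiency V a' K < deficiency V a H)"
  using least by (auto simp: not_less)

section \<open>Alternating walks\<close>

text \<open>
  \<open>reach K v s\<close> describes the end of an alternating walk from \<open>u\<close>: an extra unit of degree at \<open>v\<close>
  if \<open>s\<close> holds, a missing one otherwise. The next edge is chosen relative to the modified edge set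
  \<open>K\<close> and not to \<open>H\<close>, so a repeated edge is simply switched back, and walks need not be trails.
\<close>

inductive reach :: "'v set set \<Rightarrow> 'v \<Rightarrow> bool \<Rightarrow> bool" where
  start: "reach H u False"
| add: "reach K v False \<Longrightarrow> {v, w} \<in> E \<Longrightarrow> {v, w} \<notin> K \<Longrightarrow> reach (K \<union> star v {w}) w True"
| remove: "reach K v True \<Longrightarrow> {v, w} \<in> K \<Longrightarrow> reach (K - star v {w}) w False"

definition A :: "'v set" where "A = {v. \<exists>K. reach K v False}"
definition B :: "'v set" where "B = {v. \<exists>K. reach K v True}"

lemma reach_subset: "reach K v s \<Longrightarrow> K \<subseteq> E \<and> v \<in> V"
proof (induction rule: reach.induct)
  case start
  then show ?case using H_subset u_in_V by simp
next
  case (add K v w)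
  then show ?case using edge_ends(2) by (auto simp: star_def)
next
  case (remove K v w)
  then show ?case using edge_ends(2) by (auto simp: star_def)
qed

lemma A_subset: "A \<subseteq> V" and B_subset: "B \<subseteq> V"
  unfolding A_def B_def using reach_subset by auto

lemma u_in_A: "u \<in> A"
  unfolding A_def using start by auto

text \<open>The missing unit is written on the left, to stay clear of truncated subtraction.\<close>

lemma reach_deg:
  "reach K v s \<Longrightarrow>
     deg K x + of_bool (\<not> s \<and> x = v) = deg H x + of_bool (x = u) + of_bool (s \<and> x = v)"
proof (induction arbitrary: x rule: reach.induct)
  case start
  then show ?case by simp
next
  case (add K v w)
  have K: "K \<subseteq> E" using reach_subset add.hyps by blast
  have "v \<noteq> w" using edge_ends(3) add.hyps by blast
  have "deg (K \<union> star v {w}) x = deg K x + deg (star v {w}) x"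
    using K finite_E add.hyps by (intro deg_Un) (auto simp: star_def intro: finite_subset)
  moreover have "deg (star v {w}) x = of_bool (x = v) + of_bool (x = w)"
    using \<open>v \<noteq> w\<close> by (cases "x = v") (auto simp: deg_star_centre deg_star_leaf)
  ultimately show ?case using add.IH[of x] \<open>v \<noteq> w\<close> by (auto split: if_splits)
next
  case (remove K v w)
  have K: "K \<subseteq> E" using reach_subset remove.hyps by blast
  have "v \<noteq> w" using edge_ends(3) remove.hyps K by blast
  have "deg (K - star v {w}) x + deg (star v {w}) x = deg K x"
    using K finite_E remove.hyps by (intro deg_Diff) (auto simp: star_def intro: finite_subset)
  moreover have "deg (star v {w}) x = of_bool (x = v) + of_bool (x = w)"
    using \<open>v \<noteq> w\<close> by (cases "x = v") (auto simp: deg_star_centre deg_star_leaf)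
  ultimately show ?case using remove.IH[of x] \<open>v \<noteq> w\<close> by (auto split: if_splits)
qed

text \<open>Otherwise the excess unit at \<open>w\<close> would fit into its window, and \<open>u\<close> would have gained.\<close>

lemma B_saturated:
  assumes "w \<in> B"
  shows "deg H w = a w + 1" "w \<noteq> u"
proof -
  obtain K where r: "reach K w True" using assms unfolding B_def by auto
  note d = reach_deg[OF r] and s = reach_subset[OF r]
  have "deg H w = a w + 1 \<and> w \<noteq> u"
  proof (rule ccontr)
    assume "\<not> (deg H w = a w + 1 \<and> w \<noteq> u)"
    then have n: "w = u \<or> deg H w \<le> a w" using deg_H_le[of w] s by force
    have "feasible a K \<and> deficiency V a K < deficiency V a H"
    proof (rule improvement)
      show "a x \<in> {m x, p x} \<and> deg K x \<le> a x + 1" if "x \<in> V" for x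
      proof -
        have "deg K x \<le> a x + 1"
          using deg_H_le[OF that] d[of x] n u_deficient
          by (cases "x = u"; cases "x = w") simp_all
        then show ?thesis using window[OF that] by simp
      qed
      show "a x - deg K x \<le> a x - deg H x" for x using d[of x] by simp
      show "a u - deg K u < a u - deg H u" using d[of u] u_deficient by simp
    qed (use s in auto)
    then show False using no_improvement by blast
  qed
  then show "deg H w = a w + 1" "w \<noteq> u" by auto
qed

text \<open>Otherwise \<open>v\<close> could spare the missing unit.\<close>

lemma A_unsaturated:
  assumes "v \<in> A"
  shows "deg H v \<le> a v"
proof (rule ccontr)
  assume n: "\<not> deg H v \<le> a v"
  obtain K where r: "reach K v False" using assms unfolding A_def by auto
  note d = reach_deg[OF r] and s = reach_subset[OF r]
  have "v \<noteq> u" using n u_deficient by auto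
  have "feasible a K \<and> deficiency V a K < deficiency V a H"
  proof (rule improvement)
    show "a x \<in> {m x, p x} \<and> deg K x \<le> a x + 1" if "x \<in> V" for x
      using window[OF that] deg_H_le[OF that] d[of x] u_deficient
      by (cases "x = u"; cases "x = v") simp_all
    show "a x - deg K x \<le> a x - deg H x" for x
      using d[of x] n \<open>v \<noteq> u\<close> by (cases "x = v") auto
    show "a u - deg K u < a u - deg H u"
      using d[of u] u_deficient \<open>v \<noteq> u\<close> by auto
  qed (use s in auto)
  then show False using no_improvement by blast
qed

lemma A_B_disjoint: "A \<inter> B = {}"
  using A_unsaturated B_saturated(1) by fastforce

lemma reach_switched:
  assumes "reach K v s" "{x, y} \<in> (K - H) \<union> (H - K)"
  shows "(x \<in> A \<and> y \<in> B) \<or> (x \<in> B \<and> y \<in> A)"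
  using assms
proof (induction rule: reach.induct)
  case (add K v w)
  have "v \<in> A" "w \<in> B"
    using add.hyps reach.add unfolding A_def B_def by blast+
  then show ?case using add by (auto simp: star_def doubleton_eq_iff)
next
  case (remove K v w)
  have "v \<in> B" "w \<in> A"
    using remove.hyps reach.remove unfolding A_def B_def by blast+
  then show ?case using remove by (auto simp: star_def doubleton_eq_iff)
qed simp

text \<open>
  The walk to \<open>v\<close> can be continued along the edge to \<open>w\<close> unless this edge has been switched on the
  way; a switched edge joins \<open>A\<close> and \<open>B\<close> anyway. The same reason gives the dual statement.
\<close>

lemma A_closed:
  assumes "v \<in> A" "{v, w} \<in> E - H"
  shows "w \<in> B"
proof -
  obtain K where r: "reach K v False" using assms unfolding A_def by auto
  show ?thesis
  proof (cases "{v, w} \<in> K")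
    case True
    then have "(v \<in> A \<and> w \<in> B) \<or> (v \<in> B \<and> w \<in> A)"
      using reach_switched[OF r] assms by blast
    then show ?thesis using A_B_disjoint assms by auto
  next
    case False
    then have "reach (K \<union> star v {w}) w True" using reach.add[OF r] assms by auto
    then show ?thesis unfolding B_def by auto
  qed
qed

lemma B_closed:
  assumes "w \<in> B" "{w, v} \<in> H"
  shows "v \<in> A"
proof -
  obtain K where r: "reach K w True" using assms unfolding B_def by auto
  show ?thesis
  proof (cases "{w, v} \<in> K")
    case False
    then have "(w \<in> A \<and> v \<in> B) \<or> (w \<in> B \<and> v \<in> A)"
      using reach_switched[OF r] assms by blast
    then show ?thesis using A_B_disjoint assms by auto
  next
    case True
    then have "reach (K - star w {v}) v False" using reach.remove[OF r] by auto
    then show ?thesis unfolding A_def by auto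
  qed
qed

section \<open>Counting the edges between the two sides\<close>

lemma cut_size_A:
  "(\<Sum>v\<in>A. card (nbrs E v \<inter> B)) = (\<Sum>v\<in>A. deg E v - deg H v) + (\<Sum>w\<in>B. a w + 1)"
proof -
  have "finite A" "finite B" using A_subset B_subset finite_V by (auto intro: finite_subset)
  have split: "card (nbrs E v \<inter> B) = (deg E v - deg H v) + card (nbrs H v \<inter> B)" if "v \<in> A" for v
  proof -
    have fin: "finite (nbrs E v)" "finite (nbrs H v)"
      using finite_nbrs H_subset by auto
    have sub: "nbrs H v \<subseteq> nbrs E v" using H_subset unfolding nbrs_def by auto
    have "nbrs E v \<inter> B = (nbrs E v - nbrs H v) \<union> (nbrs H v \<inter> B)"
      using A_closed[OF that] sub unfolding nbrs_def by auto
    moreover have "card ((nbrs E v - nbrs H v) \<union> (nbrs H v \<inter> B))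
        = card (nbrs E v - nbrs H v) + card (nbrs H v \<inter> B)"
      using fin by (intro card_Un_disjoint) auto
    moreover have "card (nbrs E v - nbrs H v) = deg E v - deg H v"
      using card_Diff_subset[OF fin(2) sub] deg_eq_card_nbrs H_subset by auto
    ultimately show ?thesis by simp
  qed
  have "(\<Sum>v\<in>A. card (nbrs H v \<inter> B)) = (\<Sum>w\<in>B. card (nbrs H w \<inter> A))"
    using \<open>finite A\<close> \<open>finite B\<close> by (rule double_count_nbrs)
  also have "\<dots> = (\<Sum>w\<in>B. a w + 1)"
  proof (rule sum.cong)
    fix w assume w: "w \<in> B"
    then have "nbrs H w \<inter> A = nbrs H w" using B_closed unfolding nbrs_def by auto
    then show "card (nbrs H w \<inter> A) = a w + 1"
      using deg_eq_card_nbrs[OF H_subset] B_saturated(1)[OF w] by auto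
  qed simp
  finally show ?thesis using split by (simp add: sum.distrib)
qed

text \<open>
  The deficient vertex \<open>u\<close> makes the count exceed the capacity of the windows strictly, so the
  demands below, which share each edge between its two ends, cannot hold everywhere.
\<close>

lemma overloaded_vertex:
  fixes c :: real
  obtains (in_A) v where "v \<in> A" "(1 - c) * card (nbrs E v \<inter> B) > real (deg E v) - real (a v)"
  | (in_B) w where "w \<in> B" "c * card (nbrs E w \<inter> A) > real (a w) + 1"
proof -
  have fin: "finite A" "finite B" using A_subset B_subset finite_V by (auto intro: finite_subset)
  let ?e = "\<Sum>v\<in>A. real (card (nbrs E v \<inter> B))"
  have e: "?e = (\<Sum>w\<in>B. real (card (nbrs E w \<inter> A)))"
    using double_count_nbrs[OF fin, of E] by (simp flip: of_nat_sum)
  have deg_le: "deg H v \<le> deg E v" for v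
    unfolding deg_def using H_subset finite_E by (intro card_mono) auto
  have "?e = real ((\<Sum>v\<in>A. deg E v - deg H v) + (\<Sum>w\<in>B. a w + 1))"
    using cut_size_A by (simp flip: of_nat_sum)
  also have "\<dots> = (\<Sum>v\<in>A. real (deg E v) - real (deg H v)) + (\<Sum>w\<in>B. real (a w) + 1)"
    using deg_le by (simp add: of_nat_diff add.commute)
  finally have exact: "?e = \<dots>" .
  have "(\<Sum>v\<in>A. real (deg E v) - real (a v)) < (\<Sum>v\<in>A. real (deg E v) - real (deg H v))"
    using A_unsaturated u_in_A u_deficient fin by (intro sum_strict_mono_ex1) auto
  then have over: "?e > (\<Sum>v\<in>A. real (deg E v) - real (a v)) + (\<Sum>w\<in>B. real (a w) + 1)"
    using exact by linarith
  have "\<not> ((\<forall>v\<in>A. (1 - c) * card (nbrs E v \<inter> B) \<le> real (deg E v) - real (a v))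
      \<and> (\<forall>w\<in>B. c * card (nbrs E w \<inter> A) \<le> real (a w) + 1))"
  proof
    assume "(\<forall>v\<in>A. (1 - c) * card (nbrs E v \<inter> B) \<le> real (deg E v) - real (a v))
      \<and> (\<forall>w\<in>B. c * card (nbrs E w \<inter> A) \<le> real (a w) + 1)"
    then have "(\<Sum>v\<in>A. (1 - c) * card (nbrs E v \<inter> B)) \<le> (\<Sum>v\<in>A. real (deg E v) - real (a v))"
      and "(\<Sum>w\<in>B. c * card (nbrs E w \<inter> A)) \<le> (\<Sum>w\<in>B. real (a w) + 1)"
      by (auto intro!: sum_mono)
    then have "(1 - c) * ?e + c * ?e
        \<le> (\<Sum>v\<in>A. real (deg E v) - real (a v)) + (\<Sum>w\<in>B. real (a w) + 1)"
      by (subst (2) e) (simp add: sum_distrib_left)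
    moreover have "(1 - c) * ?e + c * ?e = ?e" by (simp add: algebra_simps)
    ultimately show False using over by linarith
  qed
  then show thesis using in_A in_B by force
qed

section \<open>Changing the window of a vertex\<close>

text \<open>
  Starting from a walk that leaves its missing unit at \<open>v\<close>, edges from \<open>v\<close> to \<open>B\<close> can be deleted
  freely: their ends in \<open>B\<close> sit at the top of their windows.
\<close>

lemma lowering_improves:
  assumes "v \<in> A" "a v = p v" "m v < p v" "card (nbrs E v - B) \<le> m v + 1"
  obtains a' K where "feasible a' K" "deficiency V a' K < deficiency V a H"
proof -
  obtain K where r: "reach K v False" using assms unfolding A_def by auto
  note d = reach_deg[OF r]
  have K: "K \<subseteq> E" using reach_subset[OF r] by auto
  have vB: "v \<notin> B" using assms A_B_disjoint by auto
  have fin: "finite (nbrs K v)" "finite (nbrs E v)" using finite_nbrs K by auto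
  have "card (nbrs K v) = card (nbrs K v \<inter> B) + card (nbrs K v - B)"
    using fin by (metis card_Int_Diff)
  moreover have "card (nbrs K v - B) \<le> card (nbrs E v - B)"
    using fin K by (intro card_mono) (auto simp: nbrs_def)
  ultimately have "deg K v - (m v + 1) \<le> card (nbrs K v \<inter> B)"
    using assms(4) deg_eq_card_nbrs[OF K, of v] by linarith
  \<comment> \<open>nothing is deleted if the degree of \<open>v\<close> is already within or below the low window\<close>
  then obtain X where X: "X \<subseteq> nbrs K v \<inter> B" "card X = deg K v - (m v + 1)"
    by (meson obtain_subset_with_card_n)
  define K' where "K' = K - star v X"
  have dK': "deg K' x + deg (star v X) x = deg K x" for x
    unfolding K'_def using X K finite_E
    by (intro deg_Diff) (auto simp: star_def nbrs_def intro: finite_subset)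
  have dv: "deg K' v = min (deg K v) (m v + 1)"
    using dK'[of v] X(2) by (simp add: deg_star_centre)
  have dx: "deg K' x + of_bool (x \<in> X) = deg H x + of_bool (x = u)" if "x \<noteq> v" for x
    using dK'[of x] d[of x] that by (simp add: deg_star_leaf)
  have uX: "u \<notin> X" using X B_saturated(2) by auto
  have sat: "deg H x = a x + 1" if "x \<in> X" for x using that X B_saturated(1) by auto
  have dv': "deg K v + 1 = deg H v + of_bool (v = u)" using d[of v] by simp
  have "feasible (a(v := m v)) K' \<and> deficiency V (a(v := m v)) K' < deficiency V a H"
  proof (rule improvement)
    show "K' \<subseteq> E" using K unfolding K'_def by auto
    show "(a(v := m v)) x \<in> {m x, p x} \<and> deg K' x \<le> (a(v := m v)) x + 1" if "x \<in> V" for x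
    proof -
      have "deg K' x \<le> (a(v := m v)) x + 1"
        using deg_H_le[OF that] dx[of x] dv u_deficient
        by (cases "x = v"; cases "x = u") simp_all
      then show ?thesis using window[OF that] by simp
    qed
    show "(a(v := m v)) x - deg K' x \<le> a x - deg H x" for x
    proof (cases "x = v")
      case True
      then show ?thesis using dv dv' assms(2,3) by simp
    next
      case False
      then show ?thesis using dx[OF False] sat[of x] by (cases "x \<in> X") simp_all
    qed
    show "(a(v := m v)) u - deg K' u < a u - deg H u"
      using dx[of u] uX dv dv' assms(2,3) u_deficient by (cases "u = v") simp_all
  qed
  then show thesis using that by blast
qed

text \<open>
  Dually, starting from a walk that leaves its extra unit at \<open>w\<close>, edges from \<open>w\<close> to \<open>A\<close> can be
  added freely, since their ends in \<open>A\<close> have room for one more edge.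
\<close>

lemma raising_improves:
  assumes "w \<in> B" "a w = m w" "m w < p w" "p w \<le> card (nbrs E w \<inter> A)"
  obtains a' K where "feasible a' K" "deficiency V a' K < deficiency V a H"
proof -
  obtain K where r: "reach K w True" using assms unfolding B_def by auto
  note d = reach_deg[OF r]
  have K: "K \<subseteq> E" using reach_subset[OF r] by auto
  have wu: "w \<noteq> u" and dHw: "deg H w = m w + 1" using B_saturated assms by auto
  have wA: "w \<notin> A" using assms A_B_disjoint by auto
  have fin: "finite (nbrs K w)" "finite (nbrs E w)" using finite_nbrs K by auto
  have "nbrs K w \<subseteq> nbrs E w \<inter> A"
  proof
    fix x assume "x \<in> nbrs K w"
    then have x: "{w, x} \<in> K" unfolding nbrs_def by auto
    have "x \<in> A"
      using B_closed[OF assms(1), of x] reach_switched[OF r, of w x] x wA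
      by (cases "{w, x} \<in> H") auto
    then show "x \<in> nbrs E w \<inter> A" using x K unfolding nbrs_def by auto
  qed
  then have "card (nbrs E w \<inter> A - nbrs K w) = card (nbrs E w \<inter> A) - deg K w"
    using card_Diff_subset fin deg_eq_card_nbrs[OF K] by metis
  then have "p w - deg K w \<le> card (nbrs E w \<inter> A - nbrs K w)" using assms(4) by linarith
  \<comment> \<open>nothing is added if \<open>p w\<close> is \<open>m w + 1\<close> or \<open>m w + 2\<close>: the degree \<open>m w + 2\<close> then fits the high window\<close>
  then obtain X where X: "X \<subseteq> nbrs E w \<inter> A - nbrs K w" "card X = p w - deg K w"
    by (meson obtain_subset_with_card_n)
  define K' where "K' = K \<union> star w X"
  have starE: "star w X \<subseteq> E" using X unfolding star_def nbrs_def by auto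
  have dK': "deg K' x = deg K x + deg (star w X) x" for x
    unfolding K'_def using X K starE finite_E
    by (intro deg_Un) (auto simp: star_def nbrs_def intro: finite_subset)
  have dw: "deg K' w = max (p w) (m w + 2)"
    using dK'[of w] d[of w] X(2) wu dHw by (simp add: deg_star_centre)
  have dx: "deg K' x = deg H x + of_bool (x = u) + of_bool (x \<in> X)" if "x \<noteq> w" for x
    using dK'[of x] d[of x] that by (simp add: deg_star_leaf)
  have unsat: "deg H x \<le> a x" if "x \<in> X" for x using that X A_unsaturated by auto
  have "feasible (a(w := p w)) K' \<and> deficiency V (a(w := p w)) K' < deficiency V a H"
  proof (rule improvement)
    show "K' \<subseteq> E" using K starE unfolding K'_def by auto
    show "(a(w := p w)) x \<in> {m x, p x} \<and> deg K' x \<le> (a(w := p w)) x + 1" if "x \<in> V" for x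
    proof -
      have "deg K' x \<le> a x + 1" if "x \<noteq> w"
        using deg_H_le[OF \<open>x \<in> V\<close>] dx[OF that] unsat[of x] u_deficient
        by (cases "x = u"; cases "x \<in> X") simp_all
      then have "deg K' x \<le> (a(w := p w)) x + 1" using dw assms(3) by simp
      then show ?thesis using window[OF that] by simp
    qed
    show "(a(w := p w)) x - deg K' x \<le> a x - deg H x" for x
      using dx[of x] dw by (cases "x = w") auto
    show "(a(w := p w)) u - deg K' u < a u - deg H u"
      using dx[of u] wu u_deficient by auto
  qed
  then show thesis using that by blast
qed

end

section \<open>Factors with two windows\<close>

text \<open>
  The hypotheses \<open>low\<close> and \<open>high\<close> say that the low window never overloads a vertex of \<open>A\<close>, nor the
  high one a vertex of \<open>B\<close>. The hypotheses \<open>stay_high\<close> and \<open>stay_low\<close> say that a vertex which cannot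
  change its window is not overloaded; there \<open>k\<close> stands for the number of its neighbours on the
  other side.
\<close>

lemma (in two_windows) two_window_factor:
  fixes c :: real
  assumes c: "0 \<le> c" "c \<le> 1"
    and low: "\<And>v. v \<in> V \<Longrightarrow> real (m v) \<le> c * deg E v"
    and high: "\<And>v. v \<in> V \<Longrightarrow> c * deg E v \<le> real (p v) + 1"
    and stay_high: "\<And>v k. v \<in> V \<Longrightarrow> m v + 2 + k \<le> deg E v \<Longrightarrow>
      (1 - c) * real k \<le> real (deg E v) - real (p v)"
    and stay_low: "\<And>v k. v \<in> V \<Longrightarrow> k < p v \<Longrightarrow> k \<le> deg E v \<Longrightarrow> c * real k \<le> real (m v) + 1"
  obtains K where "K \<subseteq> E" "\<And>v. v \<in> V \<Longrightarrow> deg K v \<in> {m v, m v + 1, p v, p v + 1}"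
proof -
  have "feasible m {}" unfolding feasible_def deg_def by auto
  then obtain a H where f: "feasible a H"
    and least: "\<And>a' K. feasible a' K \<Longrightarrow> deficiency V a H \<le> deficiency V a' K"
    using ex_has_least_nat[of "\<lambda>(a, K). feasible a K" "(m, {})" "\<lambda>(a, K). deficiency V a K"]
    by auto
  have "a u \<le> deg H u" if u: "u \<in> V" for u
  proof (rule ccontr)
    assume "\<not> a u \<le> deg H u"
    then interpret least_deficiency V E m p a H u
      using f least u by unfold_locales auto
    show False
    proof (cases rule: overloaded_vertex[of c])
      case (in_A v)
      let ?k = "card (nbrs E v \<inter> B)"
      have v: "v \<in> V" using in_A A_subset by auto
      have k: "deg E v = ?k + card (nbrs E v - B)"
        using deg_eq_card_nbrs[of E v] card_Int_Diff[OF finite_nbrs[of E v], of B] by simp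
      have "(1 - c) * ?k \<le> (1 - c) * deg E v" using k c by (intro mult_left_mono) auto
      then have "a v > m v" using in_A(2) low[OF v] by (simp add: algebra_simps)
      then have a: "a v = p v" "m v < p v" using window[OF v] by auto
      have "card (nbrs E v - B) \<le> m v + 1"
        using stay_high[OF v, of ?k] in_A(2) k a by linarith
      then obtain a' K where "feasible a' K" "deficiency V a' K < deficiency V a H"
        using lowering_improves[OF in_A(1) a] by blast
      then show False using least by force
    next
      case (in_B w)
      let ?k = "card (nbrs E w \<inter> A)"
      have w: "w \<in> V" using in_B B_subset by auto
      have k: "?k \<le> deg E w"
        using deg_eq_card_nbrs[of E w] finite_nbrs[of E w] by (auto intro: card_mono)
      then have "c * ?k \<le> c * deg E w" using c by (intro mult_left_mono) auto
      then have "a w < p w" using in_B(2) high[OF w] by linarith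
      then have a: "a w = m w" "m w < p w" using window[OF w] by auto
      have "p w \<le> ?k" using stay_low[OF w, of ?k] in_B(2) k a by linarith
      then obtain a' K where "feasible a' K" "deficiency V a' K < deficiency V a H"
        using raising_improves[OF in_B(1) a] by blast
      then show False using least by force
    qed
  qed
  then have "deg H v \<in> {m v, m v + 1, p v, p v + 1}" if "v \<in> V" for v
    using f that unfolding feasible_def by (force simp: le_Suc_eq)
  then show thesis using that f unfolding feasible_def by blast
qed

text \<open>
  The threshold \<open>c2\<close> separates the windows, so it is the weight to use. A vertex stuck in its high
  window sends at most the fraction \<open>1 - c1\<close> of its edges to the other side, of total weight at most
  \<open>(1 - c2) * (1 - c1)\<close>, and has at least the fraction \<open>1 - c3\<close> of its edges left outside its
  window. A vertex stuck in its low window sends at most the fraction \<open>c3\<close>, of weight at most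
  \<open>c2 * c3\<close>, while its window holds the fraction \<open>c1\<close>. The two conditions on the constants compare
  these fractions.
\<close>

lemma window_factor_between_fractions:
  fixes c1 c2 c3 :: real and am ap :: "'v \<Rightarrow> int"
  assumes "0 < c1" "c1 < c2" "c2 < c3" "c3 < 1"
    and c3: "c3 - c1 * (1 - c3) / (1 - c1) \<le> c2"
    and c1: "c1 \<ge> c3 * c2"
    and "simple_edges V E"
    and am: "\<And>v. v \<in> V \<Longrightarrow> c1 * deg E v \<le> am v \<and> am v \<le> c2 * deg E v"
    and ap: "\<And>v. v \<in> V \<Longrightarrow> c2 * deg E v \<le> ap v \<and> ap v \<le> c3 * deg E v"
  obtains K where "K \<subseteq> E"
    "\<And>v. v \<in> V \<Longrightarrow> int (deg K v) \<in> {am v, am v + 1, ap v, ap v + 1}"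
proof -
  let ?m = "\<lambda>v. nat (am v)" and ?p = "\<lambda>v. nat (ap v)"
  interpret two_windows V E ?m ?p using assms(7) by (rule two_windows.intro)
  have nonneg: "0 \<le> am v" "0 \<le> ap v" if v: "v \<in> V" for v
  proof -
    have "0 \<le> c1 * deg E v" "0 \<le> c2 * deg E v" using assms(1,2) by auto
    then have "0 \<le> real_of_int (am v)" "0 \<le> real_of_int (ap v)" using am[OF v] ap[OF v] by linarith+
    then show "0 \<le> am v" "0 \<le> ap v" by auto
  qed
  have bounds: "c1 * deg E v \<le> real (?m v)" "real (?m v) \<le> c2 * deg E v"
    "c2 * deg E v \<le> real (?p v)" "real (?p v) \<le> c3 * deg E v" if "v \<in> V" for v
    using am[OF that] ap[OF that] nonneg[OF that] by auto
  \<comment> \<open>the first hypothesis relating the constants, in the shape in which it is used\<close>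
  have const: "(1 - c2) * (1 - c1) \<le> 1 - c3"
  proof -
    have "c1 < 1" using assms(2-4) by linarith
    have "1 - c2 \<le> 1 - c3 + c1 * (1 - c3) / (1 - c1)" using c3 by linarith
    also have "\<dots> = (1 - c3) / (1 - c1)" using \<open>c1 < 1\<close> by (simp add: field_simps)
    finally show ?thesis using \<open>c1 < 1\<close> by (simp add: pos_le_divide_eq)
  qed
  obtain K where K: "K \<subseteq> E" "\<And>v. v \<in> V \<Longrightarrow> deg K v \<in> {?m v, ?m v + 1, ?p v, ?p v + 1}"
  proof (rule two_window_factor[of c2])
    fix v k assume v: "v \<in> V" and k: "?m v + 2 + k \<le> deg E v"
    have "real (?m v) + real k \<le> real (deg E v)" using k by linarith
    then have "real k \<le> (1 - c1) * deg E v"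
      using bounds(1)[OF v] by (simp add: algebra_simps)
    then have "(1 - c2) * k \<le> (1 - c2) * ((1 - c1) * deg E v)"
      using assms(3,4) by (intro mult_left_mono) auto
    also have "\<dots> = (1 - c2) * (1 - c1) * deg E v" by simp
    also have "\<dots> \<le> (1 - c3) * deg E v" using const by (intro mult_right_mono) auto
    finally show "(1 - c2) * real k \<le> real (deg E v) - real (?p v)"
      using bounds(4)[OF v] by (simp add: algebra_simps)
  next
    fix v k assume v: "v \<in> V" and k: "k < ?p v"
    have "real k \<le> c3 * deg E v" using bounds(4)[OF v] k by linarith
    then have "c2 * k \<le> c2 * (c3 * deg E v)" using assms(1,2) by (intro mult_left_mono) auto
    also have "\<dots> = c3 * c2 * deg E v" by simp
    also have "\<dots> \<le> c1 * deg E v" using c1 by (intro mult_right_mono) auto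
    finally show "c2 * real k \<le> real (?m v) + 1" using bounds(1)[OF v] by linarith
  next
    fix v assume v: "v \<in> V"
    show "c2 * deg E v \<le> real (?p v) + 1" using bounds(3)[OF v] by linarith
  qed (use assms(1-4) bounds(2) in auto)
  have "int (deg K v) \<in> {am v, am v + 1, ap v, ap v + 1}" if "v \<in> V" for v
    using K(2)[OF that] nonneg[OF that] by auto
  then show thesis using that K(1) by blast
qed

theorem theorem2p5:
  fixes c1 c2 c3 :: real
    and G :: "'v ugraph"
    and am ap :: "'v \<Rightarrow> int"
    and L :: "'v \<Rightarrow> nat set"
  assumes "0 < c1" and "c1 < c2" and "c2 < c3" and "c3 < 1"
    and "c3 - c1 * (1 - c3) / (1 - c1) \<le> c2"
    and "c1 \<ge> c3 * c2"
    and "simple_graph G"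
    and "\<And>v. v \<in> verts G \<Longrightarrow>
           c1 * real (degree G v) \<le> real_of_int (am v) \<and>
           real_of_int (am v) \<le> c2 * real (degree G v) \<and>
           c2 * real (degree G v) \<le> real_of_int (ap v) \<and>
           real_of_int (ap v) \<le> c3 * real (degree G v)"
    and "\<And>v. v \<in> verts G \<Longrightarrow>
           L v = {k. int k \<in> {am v, am v + 1, ap v, ap v + 1}}"
  shows "\<exists>H. L_factor L G H"
proof -
  have "simple_edges (verts G) (edges G)"
    using assms(7) unfolding simple_graph_def by unfold_locales auto
  moreover have deg: "deg (edges G) = degree G"
    unfolding deg_def degree_def by simp
  ultimately obtain K where K: "K \<subseteq> edges G"
    "\<And>v. v \<in> verts G \<Longrightarrow> int (deg K v) \<in> {am v, am v + 1, ap v, ap v + 1}"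
    using window_factor_between_fractions[OF assms(1-6), of "verts G" "edges G" am ap] assms(8)
    by auto
  have "L_factor L G (verts G, K)"
    unfolding L_factor_def spanning_subgraph_def
  proof (intro conjI ballI)
    show "simple_graph (verts G, K)"
      using K(1) assms(7) unfolding simple_graph_def by (auto simp: verts_def edges_def)
    fix v assume v: "v \<in> verts G"
    have "degree (verts G, K) v = deg K v" unfolding degree_def deg_def edges_def by simp
    then show "degree (verts G, K) v \<in> L v" using K(2)[OF v] assms(9)[OF v] by simp
  qed (use K(1) in \<open>auto simp: verts_def edges_def\<close>)
  then show ?thesis by blast
qed

end
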